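(* The map $\widetilde{\mathcal{M}} : BV(\mathbb{Z}) \to BV(\mathbb{Z})$ is continuous, i.e. if $f\in BV(\mathbb{Z})$ and $\{f_j\}_{j\ge1}\subset BV(\mathbb{Z})$ satisfy $\|f_j - f\|_{BV(\mathbb{Z})} \to 0$ as $j\to\infty$, then $\big\|\widetilde{\mathcal{M}}f_j - \widetilde{\mathcal{M}}f\big\|_{BV(\mathbb{Z})} \to 0$ as $j \to \infty$.
   Context: For $f:\mathbb{Z}\to\mathbb{R}$ the total variation is $\mathrm{Var}(f) = \sum_{n\in\mathbb{Z}} |f(n+1)-f(n)|$. $BV(\mathbb{Z})$ is the space of functions $f:\mathbb{Z}\to\mathbb{R}$ with $\mathrm{Var}(f)<\infty$, a Banach space with norm $\|f\|_{BV(\mathbb{Z})} = |f(-\infty)| + \mathrm{Var}(f)$, where $f(-\infty) = \lim_{n\to-\infty} f(n)$. The discrete uncentered Hardy-Littlewood maximal function is $$\widetilde{\mathcal{M}}f(n) = \sup_{r,s\in\mathbb{Z},\; r,s\ge 0} \frac{1}{r+s+1}\sum_{k=-r}^{s} |f(n+k)|.$$ It is known (Bober, Carneiro, Hughes, Pierce) that $\mathrm{Var}(\widetilde{\mathcal{M}}f)\le \mathrm{Var}(f)$, so $\widetilde{\mathcal{M}}$ maps $BV(\mathbb{Z})$ to itself. *)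

theory Defs
  imports "HOL-Analysis.Analysis"
begin

text \<open>
  Outside \<open>BV\<close>, \<open>Var\<close> and \<open>lim_at_minus_infinity\<close> need not have their intended meaning
  (they are total functions); the lemmas below show that they do on \<open>BV\<close>.
\<close>

definition Var :: "(int \<Rightarrow> real) \<Rightarrow> real" where
  "Var f = (\<Sum>\<^sub>\<infinity>n\<in>UNIV. \<bar>f (n + 1) - f n\<bar>)"

definition BV :: "(int \<Rightarrow> real) set" where
  "BV = {f. (\<lambda>n. \<bar>f (n + 1) - f n\<bar>) summable_on UNIV}"

definition lim_at_minus_infinity :: "(int \<Rightarrow> real) \<Rightarrow> real" where
  "lim_at_minus_infinity f = Lim at_bot f"

definition norm_BV :: "(int \<Rightarrow> real) \<Rightarrow> real" where
  "norm_BV f = \<bar>lim_at_minus_infinity f\<bar> + Var f"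

definition maximal_function :: "(int \<Rightarrow> real) \<Rightarrow> int \<Rightarrow> real" where
  "maximal_function f n =
     (SUP (r, s)\<in>{0..} \<times> {0..}. (\<Sum>k=-r..s. \<bar>f (n + k)\<bar>) / of_int (r + s + 1))"

lemma BV_diff: "(\<lambda>n. f n - g n) \<in> BV" if "f \<in> BV" "g \<in> BV"
proof -
  have s: "(\<lambda>n. \<bar>f (n + 1) - f n\<bar> + \<bar>g (n + 1) - g n\<bar>) summable_on UNIV"
    using that unfolding BV_def by (auto intro: summable_on_add)
  show ?thesis
    unfolding BV_def mem_Collect_eq by (rule summable_on_comparison_test[OF s]) auto
qed

lemma abs_diff_le_Var:
  assumes "f \<in> BV"
  shows "\<bar>f m - f n\<bar> \<le> Var f"
proof -
  have 1: "\<bar>f (n + int k) - f n\<bar> \<le> Var f" for n k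
  proof -
    have "\<bar>f (n + int k) - f n\<bar> \<le> (\<Sum>i\<in>{n..<n + int k}. \<bar>f (i + 1) - f i\<bar>)"
    proof (induction k)
      case (Suc k)
      have "{n..<n + int (Suc k)} = insert (n + int k) {n..<n + int k}" by auto
      with Suc show ?case by (auto simp: algebra_simps)
    qed auto
    also have "\<dots> \<le> Var f"
      unfolding Var_def using assms
      by (intro finite_sum_le_infsum) (auto simp: BV_def)
    finally show ?thesis .
  qed
  show ?thesis
    using 1[of n "nat (m - n)"] 1[of m "nat (n - m)"] by (cases "n \<le> m") auto
qed

lemma tendsto_lim_at_minus_infinity:
  assumes "f \<in> BV"
  shows "(f \<longlongrightarrow> lim_at_minus_infinity f) at_bot"
proof -
  let ?d = "\<lambda>n. \<bar>f (n + 1) - f n\<bar>"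
  have "?d summable_on range (\<lambda>k. - int (Suc k))"
    using assms unfolding BV_def by (auto intro: summable_on_subset_banach)
  hence "(?d \<circ> (\<lambda>k. - int (Suc k))) summable_on UNIV"
    by (subst (asm) summable_on_reindex) (auto simp: inj_def)
  hence "summable (\<lambda>k. \<bar>f (- int (Suc k) + 1) - f (- int (Suc k))\<bar>)"
    by (auto dest!: summable_on_imp_summable simp: o_def)
  hence "summable (\<lambda>k. f (- int (Suc k) + 1) - f (- int (Suc k)))"
    by (rule summable_rabs_cancel)
  hence "summable (\<lambda>k. f (- int k) - f (- int (Suc k)))" by simp
  hence "(\<lambda>n. \<Sum>k<n. f (- int k) - f (- int (Suc k)))
           \<longlonglongrightarrow> (\<Sum>k. f (- int k) - f (- int (Suc k)))"
    by (rule summable_LIMSEQ)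
  moreover have "(\<Sum>k<n. f (- int k) - f (- int (Suc k))) = f 0 - f (- int n)" for n
    by (induction n) auto
  ultimately obtain L where "(\<lambda>n. f 0 - f (- int n)) \<longlonglongrightarrow> L" by auto
  from tendsto_diff[OF tendsto_const[of "f 0"] this]
  have L: "(\<lambda>n. f (- int n)) \<longlonglongrightarrow> f 0 - L" by simp
  have "(f \<longlongrightarrow> f 0 - L) at_bot"
  proof (rule topological_tendstoI)
    fix S assume "open S" "f 0 - L \<in> S"
    then obtain N where N: "\<And>n. n \<ge> N \<Longrightarrow> f (- int n) \<in> S"
      using topological_tendstoD[OF L] by (auto simp: eventually_sequentially)
    have "f x \<in> S" if "x \<le> - int N" for x
      using N[of "nat (- x)"] that by simp
    thus "eventually (\<lambda>x. f x \<in> S) at_bot"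
      by (auto simp: eventually_at_bot_linorder)
  qed
  thus ?thesis
    unfolding lim_at_minus_infinity_def by (metis tendsto_Lim trivial_limit_at_bot_linorder)
qed

lemma bdd_above_averages:
  assumes "f \<in> BV"
  shows "bdd_above ((\<lambda>(r, s). (\<Sum>k=-r..s. \<bar>f (n + k)\<bar>) / of_int (r + s + 1))
           ` ({0..} \<times> {0..}))"
proof -
  have "(\<Sum>k=-r..s. \<bar>f (n + k)\<bar>) / of_int (r + s + 1) \<le> \<bar>f 0\<bar> + Var f"
    if rs: "0 \<le> r" "0 \<le> s" for r s :: int
  proof -
    have "\<bar>f m\<bar> \<le> \<bar>f 0\<bar> + Var f" for m
      using abs_diff_le_Var[OF assms, of m 0] by linarith
    hence "(\<Sum>k=-r..s. \<bar>f (n + k)\<bar>) \<le> of_nat (card {-r..s}) * (\<bar>f 0\<bar> + Var f)"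
      by (intro sum_bounded_above)
    also have "real (card {-r..s}) = of_int (r + s + 1)" using rs by simp
    finally show ?thesis
      using rs by (simp add: divide_le_eq mult.commute)
  qed
  thus ?thesis by (intro bdd_aboveI[where M = "\<bar>f 0\<bar> + Var f"]) auto
qed

end

theory Submission
  imports Defs
begin

text \<open>
  Continuity reduces to a bound on the variation of \<open>maximal_function (F j)\<close> near \<open>\<plusminus>\<infinity>\<close> that is
  uniform in \<open>j\<close>, since on a finite window uniform convergence suffices. Write \<open>g\<close> for the maximal
  function of \<open>f\<close>, let \<open>c \<le> g\<close>, and put \<open>h = max \<bar>f\<bar> c\<close>. If \<open>g n > t\<close>, then \<open>g > t\<close> on an interval
  around \<open>n\<close> which contains a point where \<open>h > t\<close>; hence local maxima of \<open>g\<close> are points of contact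
  with \<open>h \<le> g\<close>. Summation by parts then shows that the variation of \<open>g\<close> on \<open>{A..B}\<close> exceeds that
  of \<open>h\<close> by at most \<open>(g A - c) + (g B - c)\<close>. Since the averages are uncentered, \<open>g\<close> tends to
  its infimum at both ends, so these boundary terms are small.
\<close>

section \<open>Maximal averages\<close>

lemma sum_shift_int:
  fixes u :: "int \<Rightarrow> real" and n r s :: int
  shows "(\<Sum>k=-r..s. u (n + k)) = (\<Sum>k=n-r..n+s. u k)"
  by (rule sum.reindex_bij_witness[of _ "\<lambda>k. k - n" "\<lambda>k. n + k"]) auto

text \<open>Averages are described by their endpoints and multiplied out by the length, so that one
  interval can serve all of its points.\<close>

lemma average_le_maximal_function:
  assumes "f \<in> BV" "p \<le> n" "n \<le> q"
  shows "(\<Sum>k=p..q. \<bar>f k\<bar>) \<le> maximal_function f n * of_int (q - p + 1)"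
proof -
  have "(\<lambda>(r, s). (\<Sum>k=-r..s. \<bar>f (n + k)\<bar>) / of_int (r + s + 1)) (n - p, q - n)
        \<le> maximal_function f n"
    unfolding maximal_function_def
    by (rule cSUP_upper[OF _ bdd_above_averages]) (use assms in auto)
  hence "(\<Sum>k=p..q. \<bar>f k\<bar>) / of_int (q - p + 1) \<le> maximal_function f n"
    using sum_shift_int[of "\<lambda>k. \<bar>f k\<bar>" n "n - p" "q - n"] by simp
  moreover have "of_int (q - p + 1) > (0::real)" using assms by linarith
  ultimately show ?thesis by (simp only: pos_divide_le_eq)
qed

lemma abs_le_maximal_function: "f \<in> BV \<Longrightarrow> \<bar>f n\<bar> \<le> maximal_function f n"
  using average_le_maximal_function[of f n n n] by simp

lemma less_maximal_functionE:
  assumes "f \<in> BV" "t < maximal_function f n"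
  obtains p q where "p \<le> n" "n \<le> q" "t * of_int (q - p + 1) < (\<Sum>k=p..q. \<bar>f k\<bar>)"
proof -
  let ?a = "\<lambda>(r, s). (\<Sum>k=-r..s. \<bar>f (n + k)\<bar>) / of_int (r + s + 1)"
  have "\<exists>x\<in>{0..} \<times> {0..}. t < ?a x"
    using assms bdd_above_averages[OF assms(1)] unfolding maximal_function_def
    by (subst (asm) less_cSUP_iff) auto
  then obtain r s where rs: "0 \<le> r" "0 \<le> s" "t < ?a (r, s)" by blast
  have "of_int (r + s + 1) > (0::real)" using rs by linarith
  hence "t * of_int (r + s + 1) < (\<Sum>k=-r..s. \<bar>f (n + k)\<bar>)"
    using rs(3) by (simp add: pos_less_divide_eq)
  thus thesis
    using that[of "n - r" "n + s"] rs sum_shift_int[of "\<lambda>k. \<bar>f k\<bar>" n r s]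
    by (simp add: algebra_simps)
qed

lemma maximal_function_le:
  assumes "f \<in> BV"
    and "\<And>p q. p \<le> n \<Longrightarrow> n \<le> q \<Longrightarrow> (\<Sum>k=p..q. \<bar>f k\<bar>) \<le> t * of_int (q - p + 1)"
  shows "maximal_function f n \<le> t"
  using assms less_maximal_functionE by (metis not_le)

text \<open>Applied in both directions, this makes \<open>maximal_function\<close> nonexpansive in
  the supremum norm, which controls the finite window.\<close>

lemma maximal_function_le_add:
  assumes "f \<in> BV" "f' \<in> BV" and le: "\<And>k. \<bar>f k - f' k\<bar> \<le> e"
  shows "maximal_function f n \<le> maximal_function f' n + e"
proof (rule maximal_function_le[OF assms(1)])
  fix p q :: int
  assume pq: "p \<le> n" "n \<le> q"
  have "\<bar>f k\<bar> \<le> \<bar>f' k\<bar> + e" for k using le[of k] by linarith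
  hence "(\<Sum>k=p..q. \<bar>f k\<bar>) \<le> (\<Sum>k=p..q. \<bar>f' k\<bar> + e)" by (intro sum_mono)
  also have "\<dots> = (\<Sum>k=p..q. \<bar>f' k\<bar>) + e * of_int (q - p + 1)"
    using pq by (simp add: sum.distrib)
  also have "\<dots> \<le> (maximal_function f' n + e) * of_int (q - p + 1)"
    using average_le_maximal_function[OF assms(2) pq] by (simp add: ring_distribs)
  finally show "(\<Sum>k=p..q. \<bar>f k\<bar>) \<le> (maximal_function f' n + e) * of_int (q - p + 1)" .
qed

section \<open>Variation of the maximal function on an interval\<close>

text \<open>With signs \<open>s\<close> matching the increments of \<open>g\<close>, the difference
  of the variations is at most the sum of \<open>s n\<close> times the increments of
  \<open>g - h\<close>. In the summation by parts a change from -1 to 1 contributes a nonpositive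
  term, and a change from 1 to -1 contributes 0 because it occurs at a contact point.\<close>

lemma variation_le_of_contact:
  fixes g h :: "int \<Rightarrow> real"
  assumes le: "\<And>n. h n \<le> g n"
    and reach: "\<And>n t. t < g n \<Longrightarrow> \<exists>k. h k > t \<and> (\<forall>i\<in>{min n k..max n k}. g i > t)"
    and "A \<le> B"
  shows "(\<Sum>n=A..<B. \<bar>g (n + 1) - g n\<bar>)
         \<le> (\<Sum>n=A..<B. \<bar>h (n + 1) - h n\<bar>) + (g A - h A) + (g B - h B)"
proof -
  \<comment> \<open>The one-sided form of \<open>reach\<close>. Asking only for levels below
    \<open>g m\<close> covers an infinite plateau that \<open>h\<close> approaches without touching
    it.\<close>
  define R where "R m \<longleftrightarrow> (\<forall>t<g m. \<exists>k\<ge>m. h k > t \<and> (\<forall>i\<in>{m..k}. g i > t))" for m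
  \<comment> \<open>The sign of the increment of \<open>g\<close>; on a plateau it changes from \<open>1\<close> to \<open>-1\<close> at the last
      contact point, if there is one.\<close>
  define s :: "int \<Rightarrow> real" where
    "s n = (if g n < g (n + 1) \<or> g n = g (n + 1) \<and> R (n + 1) then 1 else -1)" for n
  have s: "s n = 1 \<or> s n = -1" for n by (auto simp: s_def)
  \<comment> \<open>Otherwise the points of \<open>h\<close> reached from \<open>m\<close> lie
    strictly to the right; this forces \<open>g (m + 1) = g m\<close> and \<open>R (m + 1)\<close>,
    hence \<open>s m = 1\<close>.\<close>
  have contact: "g m = h m" if s1: "s (m - 1) = 1" and s2: "s m = -1" for m
  proof (rule ccontr)
    assume "g m \<noteq> h m"
    with le[of m] have lt: "h m < g m" by linarith
    have Rm: "R m"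
    proof (cases "g (m - 1) < g m")
      case True
      show ?thesis unfolding R_def
      proof (intro allI impI)
        fix t assume "t < g m"
        \<comment> \<open>Raising the level to at least \<open>g (m - 1)\<close> keeps the path from
          passing \<open>m - 1\<close>, so it can only go right.\<close>
        with True reach[of "max t (g (m - 1))" m] obtain k
          where k: "h k > max t (g (m - 1))" "\<forall>i\<in>{min m k..max m k}. g i > max t (g (m - 1))"
          by auto
        have "k \<ge> m"
        proof (rule ccontr)
          assume "\<not> k \<ge> m"
          hence "m - 1 \<in> {min m k..max m k}" by auto
          with k(2) have "g (m - 1) > max t (g (m - 1))" by blast
          thus False by simp
        qed
        with k show "\<exists>k\<ge>m. h k > t \<and> (\<forall>i\<in>{m..k}. g i > t)"
          by (intro exI[of _ k]) auto
      qed
    next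
      case False
      thus ?thesis using s1 by (auto simp: s_def split: if_splits)
    qed
    have later: "\<exists>k\<ge>m+1. h k > t \<and> (\<forall>i\<in>{m+1..k}. g i > t)"
      if t: "t < g m" "h m \<le> t" for t
    proof -
      obtain k where k: "k \<ge> m" "h k > t" "\<forall>i\<in>{m..k}. g i > t"
        using Rm t unfolding R_def by blast
      with t have "k \<noteq> m" by auto
      with k show ?thesis by (intro exI[of _ k]) auto
    qed
    have "g (m + 1) \<le> g m" using s2 by (auto simp: s_def split: if_splits)
    moreover have "\<not> g (m + 1) < g m"
    proof
      assume "g (m + 1) < g m"
      with later[of "max (h m) (g (m + 1))"] lt obtain k
        where "k \<ge> m + 1" "\<forall>i\<in>{m+1..k}. g i > max (h m) (g (m + 1))" by auto
      hence "g (m + 1) > max (h m) (g (m + 1))" by auto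
      thus False by simp
    qed
    ultimately have eq: "g (m + 1) = g m" by linarith
    have "R (m + 1)" unfolding R_def
    proof (intro allI impI)
      fix t assume "t < g (m + 1)"
      with later[of "max t (h m)"] lt eq
      obtain k where "k \<ge> m + 1" "h k > max t (h m)" "\<forall>i\<in>{m+1..k}. g i > max t (h m)"
        by auto
      thus "\<exists>k\<ge>m + 1. h k > t \<and> (\<forall>i\<in>{m + 1..k}. g i > t)"
        by (intro exI[of _ k]) auto
    qed
    with eq s2 show False by (auto simp: s_def split: if_splits)
  qed
  \<comment> \<open>\<open>s n\<close> times the increment of \<open>g\<close> is its absolute
    value, also on a tie; for \<open>h\<close> the product is at most the absolute value.\<close>
  have incr: "\<bar>g (n + 1) - g n\<bar> - \<bar>h (n + 1) - h n\<bar> \<le> s n * ((g (n + 1) - h (n + 1)) - (g n - h n))" for n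
    by (auto simp: s_def)
  \<comment> \<open>The endpoint term keeps the sign \<open>s (B - 1)\<close>, so the induction step
    only has to replace it by \<open>s B\<close>; there \<open>contact\<close> enters.\<close>
  have "(\<Sum>n=A..<B. \<bar>g (n + 1) - g n\<bar>)
        \<le> (\<Sum>n=A..<B. \<bar>h (n + 1) - h n\<bar>) + (g A - h A) + s (B - 1) * (g B - h B)"
    using \<open>A \<le> B\<close>
  proof (induction B rule: int_ge_induct)
    case base
    show ?case using s[of "A - 1"] le[of A] by auto
  next
    case (step B)
    have "{A..<B + 1} = insert B {A..<B}" using step.hyps by auto
    moreover have "s (B - 1) * (g B - h B) \<le> s B * (g B - h B)"
      using s[of "B - 1"] s[of B] contact[of B] le[of B] by auto
    ultimately show ?case
      using step.IH incr[of B] by (simp add: right_diff_distrib)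
  qed
  also have "s (B - 1) * (g B - h B) \<le> g B - h B"
    using s[of "B - 1"] le[of B] by auto
  finally show ?thesis by simp
qed

text \<open>The map from \<open>x\<close> to \<open>max |x| c\<close> is 1-Lipschitz, so
  \<open>?h\<close> varies no more than \<open>f\<close>; as \<open>?h\<close> is at least
  \<open>c\<close>, the boundary terms are at most the distances of the maximal function from
  \<open>c\<close>.\<close>

lemma variation_maximal_function_le:
  assumes f: "f \<in> BV" and c: "\<And>n. c \<le> maximal_function f n" and "A \<le> B"
  shows "(\<Sum>n=A..<B. \<bar>maximal_function f (n + 1) - maximal_function f n\<bar>)
         \<le> (\<Sum>n=A..<B. \<bar>f (n + 1) - f n\<bar>)
            + (maximal_function f A - c) + (maximal_function f B - c)"
proof -
  let ?g = "maximal_function f" and ?h = "\<lambda>n. max \<bar>f n\<bar> c"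
  have "(\<Sum>n=A..<B. \<bar>?g (n + 1) - ?g n\<bar>)
        \<le> (\<Sum>n=A..<B. \<bar>?h (n + 1) - ?h n\<bar>) + (?g A - ?h A) + (?g B - ?h B)"
  proof (rule variation_le_of_contact[OF _ _ \<open>A \<le> B\<close>])
    show "?h n \<le> ?g n" for n using c abs_le_maximal_function[OF f] by simp
    fix n t assume "t < ?g n"
    then obtain p q where pq: "p \<le> n" "n \<le> q" "t * of_int (q - p + 1) < (\<Sum>k=p..q. \<bar>f k\<bar>)"
      using less_maximal_functionE[OF f] by metis
    have "\<exists>k\<in>{p..q}. \<bar>f k\<bar> > t"
    proof (rule ccontr)
      assume "\<not> ?thesis"
      hence "(\<Sum>k=p..q. \<bar>f k\<bar>) \<le> (\<Sum>k=p..q. t)" by (intro sum_mono) (auto simp: not_less)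
      with pq show False by (simp add: mult.commute)
    qed
    then obtain k where k: "p \<le> k" "k \<le> q" "\<bar>f k\<bar> > t" by auto
    \<comment> \<open>The interval found for \<open>n\<close> competes in the supremum at each of
      its points, because the averages are uncentered.\<close>
    have "?g i > t" if "i \<in> {p..q}" for i
    proof -
      have "t * of_int (q - p + 1) < ?g i * of_int (q - p + 1)"
        using pq(3) average_le_maximal_function[OF f, of p i q] that by (meson atLeastAtMost_iff less_le_trans)
      moreover have "of_int (q - p + 1) > (0::real)" using pq by linarith
      ultimately show ?thesis by (simp only: mult_less_cancel_right_pos)
    qed
    have "{min n k..max n k} \<subseteq> {p..q}" using k pq by auto
    with \<open>\<And>i. i \<in> {p..q} \<Longrightarrow> ?g i > t\<close> have "\<forall>i\<in>{min n k..max n k}. ?g i > t" by blast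
    with k(3) show "\<exists>k. ?h k > t \<and> (\<forall>i\<in>{min n k..max n k}. ?g i > t)"
      by (intro exI[of _ k] conjI) auto
  qed
  also have "(\<Sum>n=A..<B. \<bar>?h (n + 1) - ?h n\<bar>) \<le> (\<Sum>n=A..<B. \<bar>f (n + 1) - f n\<bar>)"
    by (intro sum_mono) linarith
  finally show ?thesis by linarith
qed

section \<open>Behaviour at infinity\<close>

lemma finite_int_subset_symmetric_interval:
  fixes F :: "int set"
  assumes "finite F"
  obtains M where "N \<le> M" "F \<subseteq> {-M..<M}"
proof
  let ?M = "max N (\<Sum>n\<in>F. \<bar>n\<bar> + 1)"
  have "\<bar>n\<bar> + 1 \<le> (\<Sum>n\<in>F. \<bar>n\<bar> + 1)" if "n \<in> F" for n
    using that assms by (intro member_le_sum) auto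
  thus "F \<subseteq> {-?M..<?M}" by force
qed auto

text \<open>Finitely many increments carry all but \<open>e\<close> of the total variation, which
  leaves at most \<open>e\<close> for any finite set disjoint from them.\<close>

lemma BV_tail:
  assumes "f \<in> BV" "0 < e"
  obtains N where "0 \<le> N"
    "\<And>S. finite S \<Longrightarrow> S \<inter> {-N..<N} = {} \<Longrightarrow> (\<Sum>n\<in>S. \<bar>f (n + 1) - f n\<bar>) \<le> e"
proof -
  let ?d = "\<lambda>n. \<bar>f (n + 1) - f n\<bar>"
  have sm: "?d summable_on UNIV" using assms by (simp add: BV_def)
  obtain F where F: "finite F" "dist (sum ?d F) (infsum ?d UNIV) \<le> e"
    using infsum_finite_approximation[OF sm assms(2)] by auto
  obtain N where N: "0 \<le> N" "F \<subseteq> {-N..<N}"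
    using finite_int_subset_symmetric_interval[OF F(1)] by metis
  have "sum ?d S \<le> e" if S: "finite S" "S \<inter> {-N..<N} = {}" for S
  proof -
    have "sum ?d F + sum ?d S = sum ?d (F \<union> S)"
      using F S N by (intro sum.union_disjoint[symmetric]) auto
    also have "\<dots> \<le> infsum ?d UNIV"
      using F S by (intro finite_sum_le_infsum sm) auto
    finally show ?thesis using F(2) by (simp add: dist_real_def)
  qed
  with N that show thesis by blast
qed

lemma abs_diff_le_sum_increments:
  "m \<le> n \<Longrightarrow> \<bar>f n - f m\<bar> \<le> (\<Sum>k=m..<n. \<bar>f (k + 1) - f k\<bar>)" for f :: "int \<Rightarrow> real"
proof (induction n rule: int_ge_induct)
  case (step n)
  have "{m..<n + 1} = insert n {m..<n}" using step.hyps by auto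
  with step show ?case by auto
qed auto

lemma BV_oscillation_tail:
  assumes "f \<in> BV" "0 < e"
  obtains N where "0 \<le> N" "\<And>n. N \<le> n \<Longrightarrow> \<bar>f n - f N\<bar> \<le> e"
    "\<And>n. n \<le> -N \<Longrightarrow> \<bar>f n - f (-N)\<bar> \<le> e"
proof -
  obtain N where N: "0 \<le> N"
    "\<And>S. finite S \<Longrightarrow> S \<inter> {-N..<N} = {} \<Longrightarrow> (\<Sum>n\<in>S. \<bar>f (n + 1) - f n\<bar>) \<le> e"
    using BV_tail[OF assms] by metis
  have "\<bar>f n - f N\<bar> \<le> e" if "N \<le> n" for n
    using abs_diff_le_sum_increments[OF that, of f] N(2)[of "{N..<n}"] by force
  moreover have "\<bar>f n - f (-N)\<bar> \<le> e" if "n \<le> -N" for n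
    using abs_diff_le_sum_increments[OF that, of f] N(2)[of "{n..<-N}"] by force
  ultimately show thesis using that N(1) by blast
qed

text \<open>A long interval from \<open>n\<close> into the half-line has at most
  \<open>|n - K|\<close> points outside it, and their share of the average tends to zero.\<close>

lemma le_maximal_function_of_half_line:
  assumes f: "f \<in> BV" and t: "0 \<le> t"
    and "(\<forall>k\<ge>K. t \<le> \<bar>f k\<bar>) \<or> (\<forall>k\<le>K. t \<le> \<bar>f k\<bar>)"
  shows "t \<le> maximal_function f n"
proof (rule field_le_epsilon)
  fix e :: real assume e: "0 < e"
  let ?g = "maximal_function f n"
  obtain L where L: "(t * of_int \<bar>n - K\<bar>) / e < of_int L" using ex_less_of_int by blast
  define l where "l = max L 0"
  have l: "0 \<le> l" "t * of_int \<bar>n - K\<bar> \<le> e * of_int l"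
  proof -
    have "of_int L \<le> (of_int l :: real)" by (simp add: l_def)
    with L have "(t * of_int \<bar>n - K\<bar>) / e < of_int l" by linarith
    with e show "t * of_int \<bar>n - K\<bar> \<le> e * of_int l" by (simp add: pos_divide_less_eq mult.commute)
  qed (simp add: l_def)
  \<comment> \<open>\<open>{p'..q'}\<close> consists of \<open>l + 1\<close> points of the
    half-line, and \<open>{p..q}\<close> joins it to \<open>n\<close>.\<close>
  obtain p q p' q' where pq: "p \<le> n" "n \<le> q" "{p'..q'} \<subseteq> {p..q}" "\<forall>k\<in>{p'..q'}. t \<le> \<bar>f k\<bar>"
    "q' - p' = l" "q - p \<le> l + \<bar>n - K\<bar>"
    using assms(3)
  proof
    assume "\<forall>k\<ge>K. t \<le> \<bar>f k\<bar>"
    thus thesis using l(1) by (intro that[of n "max n K + l" "max n K" "max n K + l"]) auto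
  next
    assume "\<forall>k\<le>K. t \<le> \<bar>f k\<bar>"
    thus thesis using l(1) by (intro that[of "min n K - l" n "min n K - l" "min n K"]) auto
  qed
  show "t \<le> ?g + e"
  proof (rule ccontr)
    assume "\<not> t \<le> ?g + e"
    hence lt: "?g \<le> t - e" by simp
    have g0: "0 \<le> ?g" using abs_le_maximal_function[OF f, of n] by linarith
    have len: "(of_int (q - p + 1) :: real) \<le> of_int (l + 1 + \<bar>n - K\<bar>)"
      using pq(6) by (subst of_int_le_iff) linarith
    have "t * of_int (l + 1) = (\<Sum>k=p'..q'. t)"
      using pq(5) l(1) by (simp add: mult.commute flip: pq(5))
    also have "\<dots> \<le> (\<Sum>k=p'..q'. \<bar>f k\<bar>)" using pq(4) by (intro sum_mono) auto
    also have "\<dots> \<le> (\<Sum>k=p..q. \<bar>f k\<bar>)" using pq(3) by (intro sum_mono2) auto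
    also have "\<dots> \<le> ?g * of_int (q - p + 1)"
      by (rule average_le_maximal_function[OF f pq(1,2)])
    also have "\<dots> \<le> ?g * of_int (l + 1 + \<bar>n - K\<bar>)"
      by (rule mult_left_mono[OF len g0])
    also have "\<dots> \<le> (t - e) * of_int (l + 1 + \<bar>n - K\<bar>)"
      using lt l(1) by (intro mult_right_mono) auto
    also have "\<dots> = t * of_int (l + 1) + t * of_int \<bar>n - K\<bar> - e * of_int l - e * of_int (1 + \<bar>n - K\<bar>)"
      by (simp add: algebra_simps)
    finally have "e * of_int (1 + \<bar>n - K\<bar>) \<le> 0" using l(2) by linarith
    moreover have "0 < e * of_int (1 + \<bar>n - K\<bar>)" using e by (intro mult_pos_pos) auto
    ultimately show False by linarith
  qed
qed

text \<open>An interval around a distant \<open>n\<close> either misses the window, and then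
  averages at most \<open>t\<close>, or is so long that the total deviation \<open>E\<close> inside
  the window costs at most \<open>e\<close> per point.\<close>

lemma maximal_function_le_far_out:
  assumes f: "f \<in> BV" and e: "0 < e" and t: "\<And>k. k \<notin> {-K..K} \<Longrightarrow> \<bar>f k\<bar> \<le> t"
  obtains N where "\<And>n. N \<le> \<bar>n\<bar> \<Longrightarrow> maximal_function f n \<le> t + e"
proof -
  define E where "E = (\<Sum>k=-K..K. \<bar>\<bar>f k\<bar> - t\<bar>)"
  have E0: "0 \<le> E" by (auto simp: E_def intro: sum_nonneg)
  obtain L where L: "E / e < of_int L" using ex_less_of_int by blast
  \<comment> \<open>\<open>|K|\<close> allows for a negative \<open>K\<close>, where the window is
    empty.\<close>
  have "maximal_function f n \<le> t + e" if n: "\<bar>K\<bar> + L \<le> \<bar>n\<bar>" for n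
  proof (rule maximal_function_le[OF f])
    fix p q :: int assume pq: "p \<le> n" "n \<le> q"
    have "(\<Sum>k=p..q. \<bar>f k\<bar> - t) \<le> e * of_int (q - p + 1)"
    proof (cases "{p..q} \<inter> {-K..K} = {}")
      case True
      hence "(\<Sum>k=p..q. \<bar>f k\<bar> - t) \<le> 0"
        using t by (intro sum_nonpos) (auto simp: disjoint_iff)
      also have "0 \<le> e * of_int (q - p + 1)" using e pq by (intro mult_nonneg_nonneg) auto
      finally show ?thesis .
    next
      case False
      hence "L \<le> q - p + 1" using n pq by auto
      hence "E / e < of_int (q - p + 1)" using L by (meson of_int_le_iff less_le_trans)
      hence 1: "E \<le> e * of_int (q - p + 1)" using e by (simp add: pos_divide_less_eq mult.commute)
      have "(\<Sum>k=p..q. \<bar>f k\<bar> - t) \<le> (\<Sum>k=p..q. if k \<in> {-K..K} then \<bar>\<bar>f k\<bar> - t\<bar> else 0)"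
        using t by (intro sum_mono) auto
      also have "\<dots> = (\<Sum>k\<in>{p..q} \<inter> {-K..K}. \<bar>\<bar>f k\<bar> - t\<bar>)" by (subst sum.inter_restrict) auto
      also have "\<dots> \<le> E" unfolding E_def by (intro sum_mono2) auto
      finally show ?thesis using 1 by linarith
    qed
    moreover have "(\<Sum>k=p..q. \<bar>f k\<bar> - t) = (\<Sum>k=p..q. \<bar>f k\<bar>) - t * of_int (q - p + 1)"
      using pq by (simp add: sum_subtractf)
    ultimately show "(\<Sum>k=p..q. \<bar>f k\<bar>) \<le> (t + e) * of_int (q - p + 1)"
      by (simp add: ring_distribs)
  qed
  thus thesis by (rule that)
qed

text \<open>Let \<open>t\<close> be the larger of the approximate end values of \<open>|f|\<close>.
  Every point can average far towards that end, so the maximal function is at least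
  \<open>t - d\<close> everywhere; far out it is at most \<open>t + 2 * d\<close>. Hence
  \<open>d = e / 3\<close>.\<close>

lemma maximal_function_almost_minimal_far_out:
  assumes f: "f \<in> BV" and e: "0 < e"
  obtains N where "\<And>n m. N \<le> \<bar>n\<bar> \<Longrightarrow> maximal_function f n \<le> maximal_function f m + e"
proof -
  define d where "d = e / 3"
  have d: "0 < d" using e by (simp add: d_def)
  obtain K where K: "0 \<le> K" "\<And>n. K \<le> n \<Longrightarrow> \<bar>f n - f K\<bar> \<le> d" "\<And>n. n \<le> -K \<Longrightarrow> \<bar>f n - f (-K)\<bar> \<le> d"
    using BV_oscillation_tail[OF f d] by metis
  define t where "t = max \<bar>f K\<bar> \<bar>f (-K)\<bar>"
  have low: "t - d \<le> maximal_function f m" for m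
  proof -
    have "t - d \<le> \<bar>f k\<bar>" if "K \<le> k" "t = \<bar>f K\<bar>" for k using K(2)[OF that(1)] that(2) by linarith
    moreover have "t - d \<le> \<bar>f k\<bar>" if "k \<le> -K" "t = \<bar>f (-K)\<bar>" for k
      using K(3)[OF that(1)] that(2) by linarith
    moreover have "t = \<bar>f K\<bar> \<or> t = \<bar>f (-K)\<bar>" by (auto simp: t_def max_def)
    \<comment> \<open>The half-line lemma asks for a nonnegative level, whence the
      \<open>max 0\<close>.\<close>
    ultimately have "(\<forall>k\<ge>K. max 0 (t - d) \<le> \<bar>f k\<bar>) \<or> (\<forall>k\<le>-K. max 0 (t - d) \<le> \<bar>f k\<bar>)" by auto
    hence "max 0 (t - d) \<le> maximal_function f m"
      using le_maximal_function_of_half_line[OF f, of "max 0 (t - d)" K m]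
        le_maximal_function_of_half_line[OF f, of "max 0 (t - d)" "-K" m] by auto
    thus ?thesis by simp
  qed
  have "\<bar>f k\<bar> \<le> t + d" if "k \<notin> {-K..K}" for k
  proof (cases "K \<le> k")
    case True
    thus ?thesis using K(2)[OF True] unfolding t_def by linarith
  next
    case False
    hence "k \<le> -K" using that by auto
    thus ?thesis using K(3)[of k] unfolding t_def by linarith
  qed
  from maximal_function_le_far_out[OF f d this] obtain N
    where N: "\<And>n. N \<le> \<bar>n\<bar> \<Longrightarrow> maximal_function f n \<le> t + d + d" by blast
  have "maximal_function f n \<le> maximal_function f m + e" if "N \<le> \<bar>n\<bar>" for n m
    using N[OF that] low[of m] unfolding d_def by linarith
  thus thesis by (rule that)
qed

section \<open>The norm of \<open>BV\<close>\<close>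

text \<open>Large symmetric windows exhaust all finite sets, so one uniform bound gives both
  summability and the estimate.\<close>

lemma BV_Var_le_of_windows:
  assumes win: "\<And>M. N \<le> M \<Longrightarrow> (\<Sum>n=-M..<M. \<bar>f (n + 1) - f n\<bar>) \<le> C"
  shows "f \<in> BV" "Var f \<le> C"
proof -
  let ?d = "\<lambda>n. \<bar>f (n + 1) - f n\<bar>"
  have fin: "sum ?d F \<le> C" if F: "finite F" for F
  proof -
    obtain M where M: "N \<le> M" "F \<subseteq> {-M..<M}" using finite_int_subset_symmetric_interval[OF F] by metis
    have "sum ?d F \<le> sum ?d {-M..<M}" using M(2) by (intro sum_mono2) auto
    with win[OF M(1)] show ?thesis by linarith
  qed
  show "f \<in> BV" unfolding BV_def mem_Collect_eq
    by (rule nonneg_bdd_above_summable_on) (auto intro!: bdd_aboveI2[where M = C] fin)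
  thus "Var f \<le> C" unfolding Var_def BV_def
    by (intro infsum_le_finite_sums fin) auto
qed

lemma norm_BV_nonneg: "0 \<le> norm_BV f"
  by (simp add: norm_BV_def Var_def infsum_nonneg)

text \<open>Letting \<open>m\<close> tend to minus infinity in \<open>abs_diff_le_Var\<close> shows
  that convergence in \<open>BV\<close> is uniform.\<close>

lemma abs_le_norm_BV:
  assumes "f \<in> BV"
  shows "\<bar>f n\<bar> \<le> norm_BV f"
proof -
  have "((\<lambda>m. \<bar>f n - f m\<bar>) \<longlongrightarrow> \<bar>f n - lim_at_minus_infinity f\<bar>) at_bot"
    by (intro tendsto_intros tendsto_lim_at_minus_infinity assms)
  hence "\<bar>f n - lim_at_minus_infinity f\<bar> \<le> Var f"
    by (rule tendsto_upperbound) (auto intro: always_eventually abs_diff_le_Var[OF assms])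
  thus ?thesis by (simp add: norm_BV_def)
qed

text \<open>A supremum bound passes to the limit, so the limit at minus infinity never has to be
  computed.\<close>

lemma norm_BV_le:
  assumes "f \<in> BV" "\<And>n. \<bar>f n\<bar> \<le> a" "Var f \<le> b"
  shows "norm_BV f \<le> a + b"
proof -
  have "((\<lambda>m. \<bar>f m\<bar>) \<longlongrightarrow> \<bar>lim_at_minus_infinity f\<bar>) at_bot"
    by (intro tendsto_intros tendsto_lim_at_minus_infinity assms)
  hence "\<bar>lim_at_minus_infinity f\<bar> \<le> a"
    by (rule tendsto_upperbound) (auto intro: always_eventually assms)
  with assms(3) show ?thesis by (simp add: norm_BV_def)
qed

section \<open>Boundedness and continuity of the maximal operator on \<open>BV\<close>\<close>

lemma maximal_function_in_BV:
  assumes f: "f \<in> BV"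
  shows "maximal_function f \<in> BV"
proof (rule BV_Var_le_of_windows)
  fix M :: int assume M: "0 \<le> M"
  have b: "\<bar>f k\<bar> \<le> norm_BV f" for k by (rule abs_le_norm_BV[OF f])
  have up: "maximal_function f n \<le> norm_BV f" for n
  proof (rule maximal_function_le[OF f])
    fix p q :: int assume "p \<le> n" "n \<le> q"
    moreover have "(\<Sum>k=p..q. \<bar>f k\<bar>) \<le> (\<Sum>k=p..q. norm_BV f)" by (intro sum_mono b)
    ultimately show "(\<Sum>k=p..q. \<bar>f k\<bar>) \<le> norm_BV f * of_int (q - p + 1)" by (simp add: mult.commute)
  qed
  have low: "0 \<le> maximal_function f n" for n using abs_le_maximal_function[OF f, of n] by linarith
  have "(\<Sum>n=-M..<M. \<bar>f (n + 1) - f n\<bar>) \<le> Var f"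
    using f unfolding Var_def BV_def by (intro finite_sum_le_infsum) auto
  \<comment> \<open>With \<open>c = 0\<close> each boundary term is at most
    \<open>norm_BV f\<close>, whatever the window.\<close>
  with variation_maximal_function_le[OF f low, of "-M" M] up[of M] up[of "-M"] M
  show "(\<Sum>n=-M..<M. \<bar>maximal_function f (n + 1) - maximal_function f n\<bar>) \<le> Var f + 2 * norm_BV f"
    by linarith
qed

lemma maximal_function_continuous:
  assumes f: "f \<in> BV" and e: "0 < e"
  obtains d where "0 < d"
    "\<And>f'. f' \<in> BV \<Longrightarrow> norm_BV (\<lambda>n. f' n - f n) \<le> d \<Longrightarrow>
       norm_BV (\<lambda>n. maximal_function f' n - maximal_function f n) \<le> e"
proof -
  let ?M = maximal_function
  \<comment> \<open>The two tails cost \<open>10 * \<eta> + 5 * d\<close> each, the window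
    \<open>4 * d * N\<close> and the supremum \<open>d\<close>; the terms in \<open>d\<close> add up
    to at most \<open>4 * \<eta>\<close>.\<close>
  define \<eta> where "\<eta> = e / 24"
  have \<eta>: "0 < \<eta>" using e by (simp add: \<eta>_def)
  obtain N\<^sub>1 where N1: "0 \<le> N\<^sub>1"
    "\<And>S. finite S \<Longrightarrow> S \<inter> {-N\<^sub>1..<N\<^sub>1} = {} \<Longrightarrow> (\<Sum>n\<in>S. \<bar>f (n + 1) - f n\<bar>) \<le> \<eta>"
    using BV_tail[OF f \<eta>] by metis
  obtain N\<^sub>2 where N2: "\<And>n m. N\<^sub>2 \<le> \<bar>n\<bar> \<Longrightarrow> ?M f n \<le> ?M f m + \<eta>"
    using maximal_function_almost_minimal_far_out[OF f \<eta>] by metis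
  define N where "N = max N\<^sub>1 N\<^sub>2"
  have N: "0 \<le> N" "N\<^sub>1 \<le> N" "N\<^sub>2 \<le> N" using N1(1) by (auto simp: N_def)
  \<comment> \<open>A lower bound for \<open>?M f\<close> that is within \<open>2 * \<eta>\<close>
    of its values far out.\<close>
  define c where "c = ?M f N - \<eta>"
  have c_le: "c \<le> ?M f n" for n using N2[of N n] N by (simp add: c_def)
  have le_c: "?M f n \<le> c + 2 * \<eta>" if "N \<le> \<bar>n\<bar>" for n
    using N2[of n N] N that by (simp add: c_def)
  \<comment> \<open>Chosen so that \<open>5 * d + d * N = \<eta>\<close>, four times which covers
    \<open>11 * d + 4 * d * N\<close>.\<close>
  define d where "d = \<eta> / (of_int N + 5)"
  have N5: "5 \<le> of_int N + (5::real)" using N(1) by simp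
  have d: "0 < d" "d * (of_int N + 5) = \<eta>" using \<eta> N5 by (auto simp: d_def)
  have d5: "5 * d + d * of_int N = \<eta>" using d(2) by (simp add: algebra_simps)
  have dN: "0 \<le> d * of_int N" using d(1) N(1) by simp
  have "norm_BV (\<lambda>n. ?M f' n - ?M f n) \<le> e"
    if f': "f' \<in> BV" and close: "norm_BV (\<lambda>n. f' n - f n) \<le> d" for f'
  proof -
    have diff: "(\<lambda>n. f' n - f n) \<in> BV" by (rule BV_diff[OF f' f])
    have pt: "\<bar>f' k - f k\<bar> \<le> d" for k using abs_le_norm_BV[OF diff, of k] close by linarith
    have Mpt: "\<bar>?M f' n - ?M f n\<bar> \<le> d" for n
      using maximal_function_le_add[OF f' f pt, of n]
        maximal_function_le_add[OF f f', of d n] pt by (simp add: abs_minus_commute abs_le_iff)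
    have tail: "(\<Sum>n=A..<B. \<bar>(?M f' (n + 1) - ?M f (n + 1)) - (?M f' n - ?M f n)\<bar>) \<le> 10 * \<eta> + 5 * d"
      if AB: "A \<le> B" "N \<le> A \<or> B \<le> -N" for A B
    proof -
      have disj: "{A..<B} \<inter> {-N\<^sub>1..<N\<^sub>1} = {}" using AB N by auto
      have far: "N \<le> \<bar>A\<bar>" "N \<le> \<bar>B\<bar>" using AB N by auto
      have vf: "(\<Sum>n=A..<B. \<bar>f (n + 1) - f n\<bar>) \<le> \<eta>" using N1(2) disj by simp
      have "(\<Sum>n=A..<B. \<bar>(f' (n + 1) - f (n + 1)) - (f' n - f n)\<bar>) \<le> Var (\<lambda>n. f' n - f n)"
        using diff unfolding Var_def BV_def by (intro finite_sum_le_infsum) auto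
      also have "\<dots> \<le> d" using close by (simp add: norm_BV_def)
      finally have vd: "(\<Sum>n=A..<B. \<bar>(f' (n + 1) - f (n + 1)) - (f' n - f n)\<bar>) \<le> d" .
      have "(\<Sum>n=A..<B. \<bar>f' (n + 1) - f' n\<bar>)
          \<le> (\<Sum>n=A..<B. \<bar>f (n + 1) - f n\<bar> + \<bar>(f' (n + 1) - f (n + 1)) - (f' n - f n)\<bar>)"
        by (intro sum_mono) linarith
      hence vf': "(\<Sum>n=A..<B. \<bar>f' (n + 1) - f' n\<bar>) \<le> \<eta> + d"
        using vf vd by (simp add: sum.distrib)
      \<comment> \<open>Shifting the lower bound by \<open>d\<close> makes it valid for
        \<open>f'\<close>; each boundary term is then at most \<open>2 * \<eta> + 2 * d\<close>,
        uniformly in \<open>f'\<close>.\<close>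
      have "c - d \<le> ?M f' n" for n using c_le[of n] Mpt[of n] by linarith
      from variation_maximal_function_le[OF f' this AB(1)]
      have "(\<Sum>n=A..<B. \<bar>?M f' (n + 1) - ?M f' n\<bar>) \<le> 5 * \<eta> + 5 * d"
        using vf' le_c[OF far(1)] le_c[OF far(2)] Mpt[of A] Mpt[of B] by linarith
      moreover have "(\<Sum>n=A..<B. \<bar>?M f (n + 1) - ?M f n\<bar>) \<le> 5 * \<eta>"
        using variation_maximal_function_le[OF f c_le AB(1)] vf le_c[OF far(1)] le_c[OF far(2)]
        by linarith
      moreover have "(\<Sum>n=A..<B. \<bar>(?M f' (n + 1) - ?M f (n + 1)) - (?M f' n - ?M f n)\<bar>)
          \<le> (\<Sum>n=A..<B. \<bar>?M f' (n + 1) - ?M f' n\<bar> + \<bar>?M f (n + 1) - ?M f n\<bar>)"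
        by (intro sum_mono) linarith
      ultimately show ?thesis by (simp add: sum.distrib)
    qed
    have mid: "(\<Sum>n=-N..<N. \<bar>(?M f' (n + 1) - ?M f (n + 1)) - (?M f' n - ?M f n)\<bar>) \<le> 4 * (d * of_int N)"
    proof -
      have "(\<Sum>n=-N..<N. \<bar>(?M f' (n + 1) - ?M f (n + 1)) - (?M f' n - ?M f n)\<bar>) \<le> (\<Sum>n=-N..<N. 2 * d)"
      proof (rule sum_mono)
        fix n
        show "\<bar>(?M f' (n + 1) - ?M f (n + 1)) - (?M f' n - ?M f n)\<bar> \<le> 2 * d"
          using Mpt[of n] Mpt[of "n + 1"] by linarith
      qed
      also have "\<dots> = 4 * (d * of_int N)" using N(1) by simp
      finally show ?thesis .
    qed
    have win: "(\<Sum>n=-M..<M. \<bar>(?M f' (n + 1) - ?M f (n + 1)) - (?M f' n - ?M f n)\<bar>)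
        \<le> 20 * \<eta> + 10 * d + 4 * (d * of_int N)" if M: "N \<le> M" for M
    proof -
      have "{-M..<M} = ({-M..<-N} \<union> {-N..<N}) \<union> {N..<M}" using M N(1) by auto
      hence "(\<Sum>n=-M..<M. \<bar>(?M f' (n + 1) - ?M f (n + 1)) - (?M f' n - ?M f n)\<bar>)
        = (\<Sum>n=-M..<-N. \<bar>(?M f' (n + 1) - ?M f (n + 1)) - (?M f' n - ?M f n)\<bar>)
          + (\<Sum>n=-N..<N. \<bar>(?M f' (n + 1) - ?M f (n + 1)) - (?M f' n - ?M f n)\<bar>)
          + (\<Sum>n=N..<M. \<bar>(?M f' (n + 1) - ?M f (n + 1)) - (?M f' n - ?M f n)\<bar>)"
        using M N(1) by (simp add: sum.union_disjoint ivl_disj_int Int_Un_distrib2)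
      with tail[of "-M" "-N"] tail[of N M] mid M show ?thesis by simp
    qed
    have "norm_BV (\<lambda>n. ?M f' n - ?M f n) \<le> d + (20 * \<eta> + 10 * d + 4 * (d * of_int N))"
      using BV_Var_le_of_windows[where N = N, OF win] by (intro norm_BV_le Mpt) auto
    also have "\<dots> \<le> 24 * \<eta>" using d5 d(1) dN by linarith
    also have "\<dots> = e" by (simp add: \<eta>_def)
    finally show ?thesis .
  qed
  with d(1) that show thesis by blast
qed

theorem theorem2:
  shows "maximal_function \<in> BV \<rightarrow> BV \<and>
    (\<forall>(f :: int \<Rightarrow> real) (F :: nat \<Rightarrow> int \<Rightarrow> real).
       f \<in> BV \<longrightarrow> (\<forall>j\<ge>1. F j \<in> BV) \<longrightarrow>
       (\<lambda>j. norm_BV (\<lambda>n. F j n - f n)) \<longlonglongrightarrow> 0 \<longrightarrow>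
       (\<lambda>j. norm_BV (\<lambda>n. maximal_function (F j) n - maximal_function f n)) \<longlonglongrightarrow> 0)"
proof (intro conjI allI impI)
  show "maximal_function \<in> BV \<rightarrow> BV" using maximal_function_in_BV by blast
  fix f :: "int \<Rightarrow> real" and F :: "nat \<Rightarrow> int \<Rightarrow> real"
  assume f: "f \<in> BV" and F: "\<forall>j\<ge>1. F j \<in> BV"
    and lim: "(\<lambda>j. norm_BV (\<lambda>n. F j n - f n)) \<longlonglongrightarrow> 0"
  show "(\<lambda>j. norm_BV (\<lambda>n. maximal_function (F j) n - maximal_function f n)) \<longlonglongrightarrow> 0"
  proof (rule order_tendstoI)
    fix a :: real assume "a < 0"
    thus "\<forall>\<^sub>F j in sequentially. a < norm_BV (\<lambda>n. maximal_function (F j) n - maximal_function f n)"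
      using norm_BV_nonneg by (intro always_eventually allI) (rule less_le_trans)
  next
    fix e :: real assume e: "0 < e"
    \<comment> \<open>Halving \<open>e\<close> turns the non-strict bound into the strict one
      required.\<close>
    hence "0 < e / 2" by simp
    from maximal_function_continuous[OF f this] obtain d where d: "0 < d"
      "\<And>f'. f' \<in> BV \<Longrightarrow> norm_BV (\<lambda>n. f' n - f n) \<le> d \<Longrightarrow>
       norm_BV (\<lambda>n. maximal_function f' n - maximal_function f n) \<le> e / 2" by metis
    have "\<forall>\<^sub>F j in sequentially. norm_BV (\<lambda>n. F j n - f n) < d"
      by (rule order_tendstoD(2)[OF lim d(1)])
    thus "\<forall>\<^sub>F j in sequentially. norm_BV (\<lambda>n. maximal_function (F j) n - maximal_function f n) < e"
      using eventually_ge_at_top[of 1]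
    proof eventually_elim
      case (elim j)
      with d(2)[of "F j"] F e show ?case by simp
    qed
  qed
qed

end
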